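(* Let $(\mathbf S,\mathcal A,\to)$ be a PTS. For all processes $s,t\in\mathbf S$ and every $k\in\mathbb N$, $t\models\varphi_s^k$ if and only if $s\sqsubseteq_k^r t$. Moreover, if $s$ is finite, then $t\models\varphi_s$ if and only if $s\sqsubseteq^r t$.
   Context: A PTS is a triple $(\mathbf S,\mathcal A,\to)$ with $\mathbf S$ a countable set of processes, $\mathcal A$ a countable set of actions and $\to\subseteq\mathbf S\times\mathcal A\times\Delta(\mathbf S)$, where $\Delta(\mathbf S)$ is the set of probability distributions on $\mathbf S$ with finite support. Write $s\xrightarrow{a}\pi$ for $(s,a,\pi)\in\to$, $s\xrightarrow a$ if such $\pi$ exists and $s\not\xrightarrow a$ otherwise; $\mathrm{init}(s)=\{a\mid s\xrightarrow a\}$; $\mathrm{der}(s,a)=\{\pi\mid s\xrightarrow a\pi\}$; $\mathrm{supp}(\pi)=\{t\mid\pi(t)>0\}$; $\delta_s$ is the Dirac distribution. The depth of $s$ is $0$ if $\mathrm{init}(s)=\emptyset$, otherwise $1+\sup\{\mathrm{depth}(t)\mid a\in\mathrm{init}(s),\pi\in\mathrm{der}(s,a),t\in\mathrm{supp}(\pi)\}$. A process is finite if $\mathrm{der}(s,a)$ is finite for all $a$ and its depth is finite. Lifting: for $R\subseteq\mathbf S\times\mathbf S$, $\pi R^\dagger\pi'$ iff there are an index set $I$, weights $p_i$ and $s_i,t_i$ with $\pi=\sum_ip_i\delta_{s_i}$, $\pi'=\sum_ip_i\delta_{t_i}$, $s_iRt_i$ for all $i$. A probabilistic ready simulation is $R$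 such that whenever $sRt$: if $s\xrightarrow a\pi_s$ then $t\xrightarrow a\pi_t$ for some $\pi_t$ with $\pi_sR^\dagger\pi_t$, and if $s\not\xrightarrow a$ then $t\not\xrightarrow a$; $\sqsubseteq^r$ is the union of all probabilistic ready simulations. Up-to-$k$ ready simulations: $\sqsubseteq^r_0=\mathbf S\times\mathbf S$; $s\sqsubseteq^r_{k+1}t$ iff whenever $s\xrightarrow a\pi_s$ there is $t\xrightarrow a\pi_t$ with $\pi_s(\sqsubseteq^r_k)^\dagger\pi_t$, and whenever $s\not\xrightarrow a$ then $t\not\xrightarrow a$. Logic and satisfaction: state formulae $\varphi::=\top\mid\neg\varphi\mid\bigwedge_{j\in J}\varphi_j\mid\langle a\rangle\psi$ ($J\ne\emptyset$ at most countable), distribution formulae $\psi::=\bigoplus_{i\in I}r_i\varphi_i$ ($I$ finite nonempty, $r_i\in(0,1]$, $\sum r_i=1$); $s\models\top$ always; $s\models\neg\varphi$ iff not $s\models\varphi$; $s\models\bigwedge_j\varphi_j$ iff $s\models\varphi_j$ for all $j$; $s\models\langle a\rangle\psi$ iff $s\xrightarrow a\pi$ for some $\pi\models\psi$; $\pi\models\bigoplus_ir_i\varphi_i$ iff $\pi=\sum_ir_i\pi_i$ for some $\pi_i\in\Delta(\mathbf S)$ with $u\models\varphi_i$ for all $u\in\mathrm{supp}(\pi_i)$. Write $\langle a\rangle\varphi$ for $\langle a\rangle(1\varphi)$. Mimicking formulae: $\varphi_s^0=\top$; for $k\ge1$, $\varphi_s^k=\bigwedge_{(s,a,\pi)\in\to}\langle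 a\rangle\psi_\pi^{k-1}\wedge\bigwedge_{b\notin\mathrm{init}(s)}\neg\langle b\rangle\top$ with $\psi_\pi^k=\bigoplus_{u\in\mathrm{supp}(\pi)}\pi(u)\varphi_u^k$. For finite $s$, $\varphi_s=\varphi_s^{\mathrm{depth}(s)+1}$. *)

theory Defs
  imports "HOL-Probability.Probability" "HOL-Library.Extended_Nat"
begin

text \<open>Processes and actions are the elements of types \<open>'s\<close> and \<open>'a\<close> (of class \<^class>\<open>countable\<close>
  in the theorem); a PTS is given by its transition relation.\<close>

type_synonym ('s, 'a) transitions = "('s \<times> 'a \<times> 's pmf) set"

definition fin_dist :: "'s pmf set" where
  "fin_dist = {\<pi>. finite (set_pmf \<pi>)}"

definition pts :: "('s, 'a) transitions \<Rightarrow> bool" where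
  "pts tr \<longleftrightarrow> tr \<subseteq> UNIV \<times> UNIV \<times> fin_dist"

definition init :: "('s, 'a) transitions \<Rightarrow> 's \<Rightarrow> 'a set" where
  "init tr s = {a. \<exists>\<pi>. (s, a, \<pi>) \<in> tr}"

definition der :: "('s, 'a) transitions \<Rightarrow> 's \<Rightarrow> 'a \<Rightarrow> 's pmf set" where
  "der tr s a = {\<pi>. (s, a, \<pi>) \<in> tr}"

text \<open>The recursive equation for the depth has exactly one solution with values in
  \<open>\<nat> \<union> {\<infinity>}\<close>, see \<open>depth_unfold\<close> and \<open>depth_unique\<close> below.\<close>

definition depth_step :: "('s, 'a) transitions \<Rightarrow> ('s \<Rightarrow> enat) \<Rightarrow> 's \<Rightarrow> enat" where
  "depth_step tr d s =
     (if init tr s = {} then 0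
      else 1 + Sup {d t | a \<pi> t. a \<in> init tr s \<and> \<pi> \<in> der tr s a \<and> t \<in> set_pmf \<pi>})"

definition depth :: "('s, 'a) transitions \<Rightarrow> 's \<Rightarrow> enat" where
  "depth tr = lfp (depth_step tr)"

definition finite_process :: "('s, 'a) transitions \<Rightarrow> 's \<Rightarrow> bool" where
  "finite_process tr s \<longleftrightarrow> (\<forall>a. finite (der tr s a)) \<and> depth tr s < \<infinity>"

text \<open>A family of positive weights with sum 1 is countable, so index sets of natural numbers
  cover all index sets up to renaming.\<close>

definition lifting :: "('s \<Rightarrow> 's \<Rightarrow> bool) \<Rightarrow> 's pmf \<Rightarrow> 's pmf \<Rightarrow> bool" where
  "lifting R \<pi> \<pi>' \<longleftrightarrow>
     (\<exists>(I :: nat set) (p :: nat \<Rightarrow> real) s t.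
        (\<forall>i\<in>I. 0 < p i \<and> p i \<le> 1) \<and> (p has_sum 1) I \<and>
        (\<forall>x. ((\<lambda>i. p i * pmf (return_pmf (s i)) x) has_sum pmf \<pi> x) I) \<and>
        (\<forall>x. ((\<lambda>i. p i * pmf (return_pmf (t i)) x) has_sum pmf \<pi>' x) I) \<and>
        (\<forall>i\<in>I. R (s i) (t i)))"

definition ready_step ::
  "('s, 'a) transitions \<Rightarrow> ('s \<Rightarrow> 's \<Rightarrow> bool) \<Rightarrow> 's \<Rightarrow> 's \<Rightarrow> bool" where
  "ready_step tr R s t \<longleftrightarrow>
     (\<forall>a \<pi>\<^sub>s. (s, a, \<pi>\<^sub>s) \<in> tr \<longrightarrow> (\<exists>\<pi>\<^sub>t. (t, a, \<pi>\<^sub>t) \<in> tr \<and> lifting R \<pi>\<^sub>s \<pi>\<^sub>t)) \<and>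
     (\<forall>a. a \<notin> init tr s \<longrightarrow> a \<notin> init tr t)"

definition ready_simulation :: "('s, 'a) transitions \<Rightarrow> ('s \<Rightarrow> 's \<Rightarrow> bool) \<Rightarrow> bool" where
  "ready_simulation tr R \<longleftrightarrow> (\<forall>s t. R s t \<longrightarrow> ready_step tr R s t)"

definition ready_le :: "('s, 'a) transitions \<Rightarrow> 's \<Rightarrow> 's \<Rightarrow> bool" where
  "ready_le tr s t \<longleftrightarrow> (\<exists>R. ready_simulation tr R \<and> R s t)"

primrec ready_le_upto :: "('s, 'a) transitions \<Rightarrow> nat \<Rightarrow> 's \<Rightarrow> 's \<Rightarrow> bool" where
  "ready_le_upto tr 0 = (\<lambda>s t. True)"
| "ready_le_upto tr (Suc k) = ready_step tr (ready_le_upto tr k)"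

text \<open>Conjunctions and distribution formulae are indexed families: \<open>Conj J F\<close> is the conjunction
  of \<open>F j\<close> over \<open>j \<in> J\<close>, and \<open>Oplus I r F\<close> is the sum of \<open>r i F i\<close> over \<open>i \<in> I\<close>. Families
  rather than sets of pairs keep repeated summands apart. The side conditions on \<open>J\<close>, \<open>I\<close> and
  \<open>r\<close> are those of \<open>sform\<close> and \<open>dform\<close>.\<close>

datatype ('a, 'j, 'i) state_formula =
    Top
  | Neg "('a, 'j, 'i) state_formula"
  | Conj "'j set" "'j \<Rightarrow> ('a, 'j, 'i) state_formula"
  | Diam 'a "('a, 'j, 'i) dist_formula"
and ('a, 'j, 'i) dist_formula =
    Oplus "'i set" "'i \<Rightarrow> real" "'i \<Rightarrow> ('a, 'j, 'i) state_formula"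

primrec sform :: "('a, 'j, 'i) state_formula \<Rightarrow> bool"
  and dform :: "('a, 'j, 'i) dist_formula \<Rightarrow> bool" where
  "sform Top \<longleftrightarrow> True"
| "sform (Neg \<phi>) \<longleftrightarrow> sform \<phi>"
| "sform (Conj J F) \<longleftrightarrow> J \<noteq> {} \<and> countable J \<and> (\<forall>j\<in>J. sform (F j))"
| "sform (Diam a \<psi>) \<longleftrightarrow> dform \<psi>"
| "dform (Oplus I r F) \<longleftrightarrow>
     finite I \<and> I \<noteq> {} \<and> (\<forall>i\<in>I. 0 < r i \<and> r i \<le> 1) \<and> sum r I = 1 \<and> (\<forall>i\<in>I. sform (F i))"

primrec sat :: "('s, 'a) transitions \<Rightarrow> ('a, 'j, 'i) state_formula \<Rightarrow> 's \<Rightarrow> bool"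
  and dsat :: "('s, 'a) transitions \<Rightarrow> ('a, 'j, 'i) dist_formula \<Rightarrow> 's pmf \<Rightarrow> bool" where
  "sat tr Top = (\<lambda>s. True)"
| "sat tr (Neg \<phi>) = (\<lambda>s. \<not> sat tr \<phi> s)"
| "sat tr (Conj J F) = (\<lambda>s. \<forall>j\<in>J. sat tr (F j) s)"
| "sat tr (Diam a \<psi>) = (\<lambda>s. \<exists>\<pi>. (s, a, \<pi>) \<in> tr \<and> dsat tr \<psi> \<pi>)"
| "dsat tr (Oplus I r F) = (\<lambda>\<pi>. \<exists>\<rho>.
     (\<forall>i\<in>I. \<rho> i \<in> fin_dist) \<and>
     (\<forall>x. pmf \<pi> x = (\<Sum>i\<in>I. r i * pmf (\<rho> i) x)) \<and>
     (\<forall>i\<in>I. \<forall>u\<in>set_pmf (\<rho> i). sat tr (F i) u))"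

text \<open>The only summand of \<open>1 \<phi>\<close> carries an arbitrary index.\<close>

definition Diam1 :: "'a \<Rightarrow> ('a, 'j, 'i) state_formula \<Rightarrow> ('a, 'j, 'i) state_formula" where
  "Diam1 a \<phi> = Diam a (Oplus {undefined} (\<lambda>_. 1) (\<lambda>_. \<phi>))"

type_synonym ('s, 'a) mimic_formula = "('a, ('s \<times> 'a \<times> 's pmf) + 'a, 's) state_formula"

definition mimic_dist ::
  "('s \<Rightarrow> ('a, 'j, 's) state_formula) \<Rightarrow> 's pmf \<Rightarrow> ('a, 'j, 's) dist_formula" where
  "mimic_dist F \<pi> = Oplus (set_pmf \<pi>) (pmf \<pi>) F"

text \<open>The two conjunctions of a mimicking formula, either of which may be empty, are merged into
  one over the disjoint union of their index sets, which is nonempty. It is countable, and the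
  formula thus belongs to the logic, if the outgoing transitions are countably many
  (\<open>sform_mimic\<close>); since \<open>\<Delta>(S)\<close> is uncountable, not every PTS has this property.\<close>

primrec mimic :: "('s, 'a) transitions \<Rightarrow> nat \<Rightarrow> 's \<Rightarrow> ('s, 'a) mimic_formula" where
  "mimic tr 0 = (\<lambda>s. Top)"
| "mimic tr (Suc k) = (\<lambda>s.
     Conj ({(s', a, \<pi>). (s', a, \<pi>) \<in> tr \<and> s' = s} <+> {b. b \<notin> init tr s})
       (case_sum (\<lambda>(_, a, \<pi>). Diam a (mimic_dist (mimic tr k) \<pi>))
                 (\<lambda>b. Neg (Diam1 b Top))))"

text \<open>Meaningful for processes of finite depth only.\<close>

definition mimic_full :: "('s, 'a) transitions \<Rightarrow> 's \<Rightarrow> ('s, 'a) mimic_formula" where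
  "mimic_full tr s = mimic tr (the_enat (depth tr s) + 1) s"

lemma mono_depth_step: "mono (depth_step tr)"
proof (rule monoI, rule le_funI)
  fix d d' :: "'a \<Rightarrow> enat" and s
  assume "d \<le> d'"
  then have "Sup {d t | a \<pi> t. a \<in> init tr s \<and> \<pi> \<in> der tr s a \<and> t \<in> set_pmf \<pi>}
      \<le> Sup {d' t | a \<pi> t. a \<in> init tr s \<and> \<pi> \<in> der tr s a \<and> t \<in> set_pmf \<pi>}"
    by (auto intro!: Sup_least intro: Sup_upper2 dest: le_funD)
  then show "depth_step tr d s \<le> depth_step tr d' s"
    by (auto simp: depth_step_def intro: add_left_mono)
qed

lemma depth_unfold:
  "depth tr s =
     (if init tr s = {} then 0
      else 1 + Sup {depth tr t | a \<pi> t. a \<in> init tr s \<and> \<pi> \<in> der tr s a \<and> t \<in> set_pmf \<pi>})"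
proof -
  have "depth tr s = depth_step tr (depth tr) s"
    unfolding depth_def by (subst lfp_unfold[OF mono_depth_step]) (rule refl)
  then show ?thesis
    by (simp only: depth_step_def)
qed

lemma depth_less:
  assumes "(s, a, \<pi>) \<in> tr" "t \<in> set_pmf \<pi>"
  shows "1 + depth tr t \<le> depth tr s"
proof -
  have "depth tr t \<le> Sup {depth tr t | a \<pi> t. a \<in> init tr s \<and> \<pi> \<in> der tr s a \<and> t \<in> set_pmf \<pi>}"
    using assms by (intro Sup_upper) (auto simp: init_def der_def)
  moreover have "init tr s \<noteq> {}"
    using assms by (auto simp: init_def)
  ultimately show ?thesis
    by (subst (2) depth_unfold) (auto intro: add_left_mono)
qed

lemma depth_unique:
  assumes d: "\<And>s. d s = depth_step tr d s"
  shows "d = depth tr"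
proof (rule antisym)
  show "depth tr \<le> d"
    unfolding depth_def using d by (intro lfp_lowerbound le_funI) (metis order_refl)
  have "d s \<le> depth tr s" if "depth tr s = enat n" for n s
    using that
  proof (induction n arbitrary: s rule: less_induct)
    case (less n)
    have *: "d t \<le> depth tr t" if t: "(s, a, \<pi>) \<in> tr" "t \<in> set_pmf \<pi>" for a \<pi> t
    proof -
      have le: "1 + depth tr t \<le> enat n"
        using depth_less[OF t] less.prems by simp
      then obtain m where m: "depth tr t = enat m"
        by (cases "depth tr t") auto
      with le have "m < n"
        by (simp add: one_enat_def)
      then show ?thesis
        using less.IH m by blast
    qed
    have "Sup {d t | a \<pi> t. a \<in> init tr s \<and> \<pi> \<in> der tr s a \<and> t \<in> set_pmf \<pi>}
        \<le> Sup {depth tr t | a \<pi> t. a \<in> init tr s \<and> \<pi> \<in> der tr s a \<and> t \<in> set_pmf \<pi>}"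
      using * by (intro Sup_least) (force simp: der_def intro: Sup_upper2)
    then have "depth_step tr d s \<le> depth_step tr (depth tr) s"
      by (auto simp: depth_step_def intro: add_left_mono)
    then show ?case
      using d[of s] depth_unfold[of tr s] by (simp add: depth_step_def)
  qed
  then show "d \<le> depth tr"
    by (intro le_funI) (metis enat_ord_code(3) not_infinity_eq)
qed

lemma sform_mimic:
  fixes tr :: "('s, 'a :: countable) transitions"
  assumes "pts tr" and cnt: "\<And>s a. countable (der tr s a)"
  shows "sform (mimic tr k s)"
proof (induction k arbitrary: s)
  case (Suc k)
  have "{(s', a, \<pi>). (s', a, \<pi>) \<in> tr \<and> s' = s} = (\<Union>a. (\<lambda>\<pi>. (s, a, \<pi>)) ` der tr s a)"
    by (auto simp: der_def)
  then have "countable {(s', a, \<pi>). (s', a, \<pi>) \<in> tr \<and> s' = s}"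
    using cnt by simp
  moreover have "{(s', a, \<pi>). (s', a, \<pi>) \<in> tr \<and> s' = s} <+> {b. b \<notin> init tr s} \<noteq> {}"
    by (auto simp: init_def)
  moreover have "dform (mimic_dist (mimic tr k) \<pi>)" if "(s, a, \<pi>) \<in> tr" for a \<pi>
  proof -
    have "finite (set_pmf \<pi>)"
      using that assms(1) by (auto simp: pts_def fin_dist_def)
    then show ?thesis
      using Suc by (simp add: mimic_dist_def pmf_le_1 pmf_positive set_pmf_not_empty sum_pmf_eq_1)
  qed
  ultimately show ?case
    by (auto simp: Diam1_def Plus_def)
qed simp

end

theory Submission
  imports Defs
begin

text \<open>The lifting of a relation is the existence of a coupling supported in it. Conditioning
  a coupling of \<open>\<pi>\<close> and \<open>\<pi>'\<close> on its first component splits \<open>\<pi>'\<close> into a mixture with weights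
  \<open>\<pi>\<close>, and gluing the parts of a mixture gives a coupling back; hence \<open>\<pi>'\<close> satisfies the
  mimicking formula of \<open>\<pi>\<close> iff \<open>\<pi>\<close> is lifted-related to \<open>\<pi>'\<close>, and the first claim follows by
  induction on \<open>k\<close>. For the second claim, relate \<open>s\<close> of finite depth \<open>n\<close> to \<open>t\<close> if
  \<open>s \<sqsubseteq>\<^sup>r\<^bsub>n+1\<^esub> t\<close>. This is a ready simulation, because successors of \<open>s\<close> have depth \<open>m < n\<close> and
  the relations \<open>\<sqsubseteq>\<^sup>r\<^sub>k\<close> decrease in \<open>k\<close>.\<close>

text \<open>An image distribution is the mixture of the Dirac distributions at the points
  \<open>f i\<close>, in the very form that \<open>lifting\<close> asks for. Summing over the
  support suffices, since all other weights vanish.\<close>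

lemma has_sum_pmf_map:
  "((\<lambda>i. pmf N i * pmf (return_pmf (f i)) x) has_sum pmf (map_pmf f N) x) (set_pmf N)"
proof -
  let ?g = "\<lambda>i. pmf N i * pmf (return_pmf (f i)) x"
  have abs: "Infinite_Set_Sum.abs_summable_on ?g UNIV"
    by (rule abs_summable_on_comparison_test[OF pmf_abs_summable[of N]])
       (auto simp: indicator_def)
  have "pmf (map_pmf f N) x = infsetsum ?g UNIV"
    by (simp add: map_pmf_def pmf_bind pmf_expectation_eq_infsetsum)
  also have "\<dots> = infsum ?g UNIV"
    using abs by (rule infsetsum_infsum)
  finally have "(?g has_sum pmf (map_pmf f N) x) UNIV"
    using abs by (metis abs_summable_equivalent abs_summable_summable has_sum_infsum)
  then show ?thesis
    by (rule has_sum_cong_neutral[THEN iffD1, rotated -1]) (auto simp: pmf_eq_0_set_pmf)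
qed

text \<open>Extending the weights by 0 gives a mass function on the whole type; positivity on
  \<open>I\<close> makes the support exactly \<open>I\<close>.\<close>

lemma pmf_of_weights:
  fixes p :: "'i \<Rightarrow> real"
  assumes pos: "\<And>i. i \<in> I \<Longrightarrow> 0 < p i" and sum: "(p has_sum 1) I"
  obtains N where "set_pmf N = I" "\<And>i. i \<in> I \<Longrightarrow> pmf N i = p i"
proof -
  let ?q = "\<lambda>i. if i \<in> I then p i else 0"
  have q: "(?q has_sum 1) UNIV"
    using sum by (rule has_sum_cong_neutral[THEN iffD1, rotated -1]) auto
  have nonneg: "0 \<le> ?q i" for i
    using pos[of i] by (simp add: less_imp_le)
  have abs: "Infinite_Set_Sum.abs_summable_on ?q UNIV"
  proof -
    have "(\<lambda>i. norm (?q i)) = ?q"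
      using nonneg by (intro ext) (metis abs_of_nonneg real_norm_def)
    then have "(\<lambda>i. norm (?q i)) summable_on UNIV"
      using q by (metis has_sum_imp_summable)
    then show ?thesis
      by (simp only: abs_summable_equivalent)
  qed
  have "(\<integral>\<^sup>+i. ennreal (?q i) \<partial>count_space UNIV) = ennreal (infsetsum ?q UNIV)"
    using abs nonneg by (intro nn_integral_conv_infsetsum) auto
  also have "infsetsum ?q UNIV = 1"
    using infsetsum_infsum[OF abs] infsumI[OF q] by simp
  finally have int: "(\<integral>\<^sup>+i. ennreal (?q i) \<partial>count_space UNIV) = 1"
    by simp
  show thesis
  proof
    show "set_pmf (embed_pmf ?q) = I"
      using pos by (subst set_embed_pmf[OF nonneg int]) force
    show "pmf (embed_pmf ?q) i = p i" if "i \<in> I" for i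
      using that by (subst pmf_embed_pmf[OF nonneg int]) simp
  qed
qed

text \<open>The weights of a lifting form one distribution on indices, and both sides are its images
  under \<open>s\<close> and \<open>t\<close>. Conversely, a coupling has countable support, so its
  pairs can be numbered.\<close>

lemma lifting_iff_rel_pmf: "lifting R \<pi> \<pi>' \<longleftrightarrow> rel_pmf R \<pi> \<pi>'"
proof
  assume "lifting R \<pi> \<pi>'"
  then obtain I :: "nat set" and p s t
    where p: "\<And>i. i \<in> I \<Longrightarrow> 0 < p i" "(p has_sum 1) I"
      and s: "\<And>x. ((\<lambda>i. p i * pmf (return_pmf (s i)) x) has_sum pmf \<pi> x) I"
      and t: "\<And>x. ((\<lambda>i. p i * pmf (return_pmf (t i)) x) has_sum pmf \<pi>' x) I"
      and R: "\<And>i. i \<in> I \<Longrightarrow> R (s i) (t i)"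
    unfolding lifting_def by blast
  obtain N where N: "set_pmf N = I" "\<And>i. i \<in> I \<Longrightarrow> pmf N i = p i"
    using pmf_of_weights[OF p] by blast
  have eq: "\<rho> = map_pmf f N"
    if "\<And>x. ((\<lambda>i. p i * pmf (return_pmf (f i)) x) has_sum pmf \<rho> x) I" for \<rho> and f :: "nat \<Rightarrow> 'a"
  proof (rule pmf_eqI)
    fix x
    have "((\<lambda>i. p i * pmf (return_pmf (f i)) x) has_sum pmf (map_pmf f N) x) I"
      using has_sum_pmf_map[of N f x] unfolding N(1)
      by (rule has_sum_cong[THEN iffD1, rotated]) (simp add: N(2))
    then show "pmf \<rho> x = pmf (map_pmf f N) x"
      using that has_sum_unique by blast
  qed
  show "rel_pmf R \<pi> \<pi>'"
    unfolding eq[OF s] eq[OF t] pmf.rel_map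
    using R N(1) by (intro rel_pmf_reflI) blast
next
  assume "rel_pmf R \<pi> \<pi>'"
  then obtain pq where R: "\<And>x y. (x, y) \<in> set_pmf pq \<Longrightarrow> R x y"
    and pq: "map_pmf fst pq = \<pi>" "map_pmf snd pq = \<pi>'"
    by (auto elim: rel_pmf.cases)
  \<comment> \<open>\<open>?e\<close> numbers the pairs in the support of the coupling, and
    \<open>?d\<close> recovers a pair from its number.\<close>
  let ?e = "to_nat_on (set_pmf pq)" and ?d = "from_nat_into (set_pmf pq)"
  let ?N = "map_pmf ?e pq"
  have inv: "map_pmf (\<lambda>i. f (?d i)) ?N = map_pmf f pq" for f :: "'a \<times> 'a \<Rightarrow> 'a"
    by (auto simp: pmf.map_comp intro!: map_pmf_cong)
  \<comment> \<open>For a constant map evaluated at its value, every Dirac factor is 1, which leaves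
    the total mass.\<close>
  have "(pmf ?N has_sum 1) (set_pmf ?N)"
    using has_sum_pmf_map[of ?N "\<lambda>_. undefined" undefined] by simp
  moreover have "((\<lambda>i. pmf ?N i * pmf (return_pmf (fst (?d i))) x) has_sum pmf \<pi> x) (set_pmf ?N)" for x
    using has_sum_pmf_map[of ?N "\<lambda>i. fst (?d i)" x] by (simp only: inv pq)
  moreover have "((\<lambda>i. pmf ?N i * pmf (return_pmf (snd (?d i))) x) has_sum pmf \<pi>' x) (set_pmf ?N)" for x
    using has_sum_pmf_map[of ?N "\<lambda>i. snd (?d i)" x] by (simp only: inv pq)
  moreover have "R (fst (?d i)) (snd (?d i))" if "i \<in> set_pmf ?N" for i
    using that R by auto
  ultimately show "lifting R \<pi> \<pi>'"
    unfolding lifting_def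
    by (intro exI[of _ "set_pmf ?N"] exI[of _ "pmf ?N"]
        exI[of _ "\<lambda>i. fst (?d i)"] exI[of _ "\<lambda>i. snd (?d i)"])
       (simp add: pmf_le_1 pmf_positive)
qed

lemma rel_pmf_iff_bind:
  fixes \<pi> :: "'a pmf" and \<rho> :: "'b pmf"
  shows "rel_pmf R \<pi> \<rho> \<longleftrightarrow> (\<exists>\<sigma>. \<rho> = bind_pmf \<pi> \<sigma> \<and> (\<forall>u\<in>set_pmf \<pi>. \<forall>v\<in>set_pmf (\<sigma> u). R u v))"
proof
  assume "rel_pmf R \<pi> \<rho>"
  then obtain pq where R: "\<And>x y. (x, y) \<in> set_pmf pq \<Longrightarrow> R x y"
    and pq: "map_pmf fst pq = \<pi>" "map_pmf snd pq = \<rho>"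
    by (auto elim: rel_pmf.cases)
  let ?c = "\<lambda>u. cond_pmf pq {y. fst y = u}"
  have set_\<pi>: "set_pmf \<pi> = fst ` set_pmf pq"
    by (simp flip: pq(1))
  have ne: "set_pmf pq \<inter> {y. fst y = u} \<noteq> {}" if "u \<in> set_pmf \<pi>" for u
    using that by (auto simp: set_\<pi>)
  \<comment> \<open>Drawing \<open>u\<close> from the first marginal and then a pair given that its
    first component is \<open>u\<close> restores the coupling: each fibre of \<open>fst\<close> has
    the mass of \<open>u\<close> under \<open>\<pi>\<close>.\<close>
  have "bind_pmf \<pi> ?c = pq"
  proof (rule bind_cond_pmf_cancel)
    fix u and y :: "'a \<times> 'b"
    assume "fst y = u"
    then have "{x. fst y = x} = {u}" "{y :: 'a \<times> 'b. fst y = u} = fst -` {u}"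
      by auto
    then show "measure pq {y. fst y = u} = measure \<pi> {x. fst y = x}"
      by (simp add: pq(1)[symmetric] measure_map_pmf)
  qed (use ne in \<open>auto simp: set_\<pi>\<close>)
  then have "\<rho> = bind_pmf \<pi> (\<lambda>u. map_pmf snd (?c u))"
    using pq(2) by (metis map_bind_pmf)
  moreover have "\<forall>u\<in>set_pmf \<pi>. \<forall>v\<in>set_pmf (map_pmf snd (?c u)). R u v"
    using R by (auto simp: set_cond_pmf[OF ne])
  ultimately show "\<exists>\<sigma>. \<rho> = bind_pmf \<pi> \<sigma> \<and> (\<forall>u\<in>set_pmf \<pi>. \<forall>v\<in>set_pmf (\<sigma> u). R u v)"
    by blast
next
  assume "\<exists>\<sigma>. \<rho> = bind_pmf \<pi> \<sigma> \<and> (\<forall>u\<in>set_pmf \<pi>. \<forall>v\<in>set_pmf (\<sigma> u). R u v)"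
  then obtain \<sigma> where \<sigma>: "\<rho> = bind_pmf \<pi> \<sigma>" "\<And>u v. u \<in> set_pmf \<pi> \<Longrightarrow> v \<in> set_pmf (\<sigma> u) \<Longrightarrow> R u v"
    by blast
  \<comment> \<open>The diagonal coupling also records membership in the support, as
    \<open>\<sigma>\<close> is controlled only there.\<close>
  have "rel_pmf (\<lambda>u u'. u = u' \<and> u \<in> set_pmf \<pi>) \<pi> \<pi>"
    by (rule rel_pmf_reflI) simp
  then have "rel_pmf R (bind_pmf \<pi> return_pmf) (bind_pmf \<pi> \<sigma>)"
    by (rule rel_pmf_bindI) (auto simp: rel_pmf_return_pmf1 \<sigma>(2))
  then show "rel_pmf R \<pi> \<rho>"
    by (simp add: \<sigma>(1) bind_return_pmf')
qed

lemma dsat_mimic_dist: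
  assumes \<pi>: "\<pi> \<in> fin_dist" and \<rho>: "\<rho> \<in> fin_dist"
  shows "dsat tr (mimic_dist F \<pi>) \<rho> \<longleftrightarrow> lifting (\<lambda>u. sat tr (F u)) \<pi> \<rho>"
proof -
  have fin: "finite (set_pmf \<pi>)"
    using \<pi> by (simp add: fin_dist_def)
  have mixture: "(\<forall>x. pmf \<rho> x = (\<Sum>u\<in>set_pmf \<pi>. pmf \<pi> u * pmf (\<sigma> u) x)) \<longleftrightarrow> \<rho> = bind_pmf \<pi> \<sigma>" for \<sigma>
    by (simp add: pmf_eq_iff pmf_bind integral_measure_pmf[OF fin])
  \<comment> \<open>Each part of a mixture with positive weight has its support inside that of
    \<open>\<rho>\<close>, so finiteness is inherited.\<close>
  have "\<sigma> u \<in> fin_dist" if "\<rho> = bind_pmf \<pi> \<sigma>" "u \<in> set_pmf \<pi>" for \<sigma> u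
    using that \<rho> finite_subset[of "set_pmf (\<sigma> u)" "set_pmf \<rho>"] by (auto simp: fin_dist_def)
  then show ?thesis
    unfolding lifting_iff_rel_pmf rel_pmf_iff_bind mimic_dist_def dsat.simps mixture by blast
qed

text \<open>The target distribution itself serves as the only part, of weight 1; \<open>pts\<close>
  gives its finite support.\<close>

lemma sat_Diam1_Top:
  assumes "pts tr"
  shows "sat tr (Diam1 a Top) t \<longleftrightarrow> a \<in> init tr t"
  using assms by (fastforce simp: Diam1_def init_def pts_def)

lemma sat_mimic_iff_ready_le_upto:
  assumes "pts tr"
  shows "sat tr (mimic tr k s) t \<longleftrightarrow> ready_le_upto tr k s t"
proof (induction k arbitrary: s t)
  case (Suc k)
  have fin: "\<pi> \<in> fin_dist" if "(u, a, \<pi>) \<in> tr" for u a \<pi>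
    using that assms by (auto simp: pts_def)
  \<comment> \<open>As an equation between relations, the induction hypothesis can rewrite the
    argument of \<open>lifting\<close>.\<close>
  have IH: "(\<lambda>u. sat tr (mimic tr k u)) = ready_le_upto tr k"
    by (intro ext) (rule Suc)
  have "sat tr (Diam a (mimic_dist (mimic tr k) \<pi>)) t \<longleftrightarrow>
      (\<exists>\<rho>. (t, a, \<rho>) \<in> tr \<and> lifting (ready_le_upto tr k) \<pi> \<rho>)" if "(s, a, \<pi>) \<in> tr" for a \<pi>
    using dsat_mimic_dist[OF fin[OF that] fin, of t a _ tr "mimic tr k"]
    by (auto simp: IH)
  moreover have "sat tr (mimic tr (Suc k) s) t \<longleftrightarrow>
      (\<forall>a \<pi>. (s, a, \<pi>) \<in> tr \<longrightarrow> sat tr (Diam a (mimic_dist (mimic tr k) \<pi>)) t) \<and>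
      (\<forall>b. b \<notin> init tr s \<longrightarrow> b \<notin> init tr t)"
    by (auto simp: Plus_def ball_Un sat_Diam1_Top[OF assms])
  ultimately show ?case
    by (simp add: ready_step_def)
qed simp

lemma lifting_mono_strong:
  assumes "lifting R \<pi> \<rho>" "\<And>u v. u \<in> set_pmf \<pi> \<Longrightarrow> R u v \<Longrightarrow> R' u v"
  shows "lifting R' \<pi> \<rho>"
  using assms unfolding lifting_iff_rel_pmf by (rule pmf.rel_mono_strong)

text \<open>Comparing the relations only at successors of \<open>s\<close> is what later allows
  depth bounds on \<open>u\<close> to be used.\<close>

lemma ready_step_mono_strong:
  assumes "ready_step tr R s t"
    and "\<And>a \<pi> u v. (s, a, \<pi>) \<in> tr \<Longrightarrow> u \<in> set_pmf \<pi> \<Longrightarrow> R u v \<Longrightarrow> R' u v"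
  shows "ready_step tr R' s t"
proof -
  have "lifting R' \<pi> \<rho>" if "(s, a, \<pi>) \<in> tr" "lifting R \<pi> \<rho>" for a \<pi> \<rho>
    using that(2) assms(2)[OF that(1)] by (rule lifting_mono_strong)
  then show ?thesis
    using assms(1) unfolding ready_step_def by blast
qed

lemma ready_le_upto_Suc: "ready_le_upto tr (Suc k) s t \<Longrightarrow> ready_le_upto tr k s t"
proof (induction k arbitrary: s t)
  case (Suc k)
  have "ready_step tr (ready_le_upto tr (Suc k)) s t"
    using Suc.prems by simp
  then have "ready_step tr (ready_le_upto tr k) s t"
    by (rule ready_step_mono_strong) (rule Suc.IH)
  then show ?case
    by simp
qed simp

lemma ready_le_upto_antimono: "j \<le> k \<Longrightarrow> ready_le_upto tr k s t \<Longrightarrow> ready_le_upto tr j s t"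
  by (induction k rule: dec_induct) (auto dest: ready_le_upto_Suc simp del: ready_le_upto.simps)

text \<open>A fixed ready simulation lies in every approximant: monotonicity of
  \<open>ready_step\<close> carries the inclusion from \<open>k\<close> to
  \<open>Suc k\<close>.\<close>

lemma ready_le_imp_upto: "ready_le tr s t \<Longrightarrow> ready_le_upto tr k s t"
proof -
  assume "ready_le tr s t"
  then obtain R where R: "ready_simulation tr R" "R s t"
    by (auto simp: ready_le_def)
  then show ?thesis
  proof (induction k arbitrary: s t)
    case (Suc k)
    then have "ready_step tr R s t"
      by (simp add: ready_simulation_def)
    then have "ready_step tr (ready_le_upto tr k) s t"
      by (rule ready_step_mono_strong) (rule Suc.IH[OF Suc.prems(1)])
    then show ?case
      by simp
  qed simp
qed

lemma ready_le_iff_upto_depth: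
  assumes "depth tr s = enat n"
  shows "ready_le tr s t \<longleftrightarrow> ready_le_upto tr (Suc n) s t"
proof
  \<comment> \<open>The index varies with the depth of the left process. It exceeds the depth by one
    because even a process of depth 0 needs one step to compare initial actions.\<close>
  let ?R = "\<lambda>s t. \<exists>n. depth tr s = enat n \<and> ready_le_upto tr (Suc n) s t"
  have "ready_simulation tr ?R"
    unfolding ready_simulation_def
  proof (intro allI impI)
    fix s t
    assume "?R s t"
    then obtain n where n: "depth tr s = enat n" "ready_step tr (ready_le_upto tr n) s t"
      by auto
    show "ready_step tr ?R s t"
      using n(2)
    proof (rule ready_step_mono_strong)
      fix a \<pi> u v
      assume u: "(s, a, \<pi>) \<in> tr" "u \<in> set_pmf \<pi>" and v: "ready_le_upto tr n u v"
      have le: "1 + depth tr u \<le> enat n"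
        using depth_less[OF u] n(1) by simp
      then obtain m where m: "depth tr u = enat m"
        by (cases "depth tr u") auto
      \<comment> \<open>The step from \<open>s\<close> uses up one level, and level \<open>n\<close>
        still covers the level \<open>Suc m\<close> that \<open>?R\<close> requires at
        \<open>u\<close>.\<close>
      with le have "Suc m \<le> n"
        by (simp add: one_enat_def)
      then show "?R u v"
        using m ready_le_upto_antimono[OF _ v] by (intro exI conjI)
    qed
  qed
  moreover assume "ready_le_upto tr (Suc n) s t"
  ultimately show "ready_le tr s t"
    unfolding ready_le_def using assms by (intro exI[of _ ?R]) (simp del: ready_le_upto.simps)
qed (rule ready_le_imp_upto)

theorem theorem3:
  fixes tr :: "('s :: countable, 'a :: countable) transitions"
  assumes "pts tr"
  shows "(\<forall>s t k. sat tr (mimic tr k s) t \<longleftrightarrow> ready_le_upto tr k s t) \<and>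
         (\<forall>s t. finite_process tr s \<longrightarrow> (sat tr (mimic_full tr s) t \<longleftrightarrow> ready_le tr s t))"
proof (intro conjI allI impI)
  fix s t
  assume "finite_process tr s"
  then obtain n where "depth tr s = enat n"
    by (auto simp: finite_process_def)
  then show "sat tr (mimic_full tr s) t \<longleftrightarrow> ready_le tr s t"
    unfolding mimic_full_def sat_mimic_iff_ready_le_upto[OF assms]
    by (simp add: ready_le_iff_upto_depth)
qed (rule sat_mimic_iff_ready_le_upto[OF assms])

end
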